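(* Let $(F_n)_{n\ge 0}$ be the finite Fibonacci strings defined by $F_0=b$, $F_1=a$, $F_n=F_{n-1}F_{n-2}$ for $n\ge 2$. The set of all right seeds of $F_n$ is: (i) $\{F_n\}$ if $n\in\{0,1,2\}$; (ii) $\{F_n,F_{n-2},F_{n-4},F_{n-6},\dots,F_3\}\cup\{xF_{n-3}F_{n-2} : x\text{ a possibly empty suffix of }F_{n-2}\}$ if $n=2k+1$ with $k\ge 1$; (iii) $\{F_n,F_{n-2},F_{n-4},F_{n-6},\dots,F_4\}\cup\{xF_{n-3}F_{n-2} : x\text{ a possibly empty suffix of }F_{n-2}\}$ if $n=2k$ with $k\ge 2$.
   Context: Strings are over the alphabet $\{a,b\}$, where $a$ and $b$ are distinct letters. $|y|$ is the length of a string $y$, and $y[i\ldots j]$ denotes its factor from position $i$ to position $j$ (positions start at 1). A nonempty string $x$ of length $m$ is a cover of a string $y$ of length $n\ge m$ if there is a set of positions $P\subseteq\{1,\dots,n-m+1\}$ such that $y[i\ldots i+m-1]=x$ for all $i\in P$ and $\bigcup_{i\in P}\{i,\dots,i+m-1\}=\{1,\dots,n\}$; in particular $y$ is a cover of itself. A right seed of a string $y$ is a nonempty suffix of $y$ that is a cover of some string of the form $vy$, where $v$ is a possibly empty string. *)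

theory Defs
  imports Main "HOL-Library.Sublist"
begin

datatype letter = letter_a | letter_b

type_synonym str = "letter list"

text \<open>The factor \<open>y[i\<dots>j]\<close>, where positions start at 1.\<close>

definition factor :: "'a list \<Rightarrow> nat \<Rightarrow> nat \<Rightarrow> 'a list" where
  "factor y i j = take (j + 1 - i) (drop (i - 1) y)"

text \<open>The condition \<open>length x \<le> length y\<close> makes the subtraction in the range of \<open>P\<close> exact.\<close>

definition is_cover :: "'a list \<Rightarrow> 'a list \<Rightarrow> bool" where
  "is_cover x y \<longleftrightarrow> x \<noteq> [] \<and> length x \<le> length y \<and>
     (\<exists>P \<subseteq> {1..length y - length x + 1}.
        (\<forall>i\<in>P. factor y i (i + length x - 1) = x) \<and>
        (\<Union>i\<in>P. {i..i + length x - 1}) = {1..length y})"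

definition right_seed :: "'a list \<Rightarrow> 'a list \<Rightarrow> bool" where
  "right_seed x y \<longleftrightarrow> x \<noteq> [] \<and> suffix x y \<and> (\<exists>v. is_cover x (v @ y))"

fun fib_str :: "nat \<Rightarrow> str" where
  "fib_str 0 = [letter_b]"
| "fib_str (Suc 0) = [letter_a]"
| "fib_str (Suc (Suc n)) = fib_str (Suc n) @ fib_str n"

end

theory Submission
  imports Defs
begin

text \<open>
  Right seeds of \<open>F\<^sub>n\<close> of length at least \<open>|F\<^sub>n\<^sub>-\<^sub>1|\<close>: every \<open>s = xF\<^sub>n\<^sub>-\<^sub>3F\<^sub>n\<^sub>-\<^sub>2\<close> covers
  \<open>sF\<^sub>n\<^sub>-\<^sub>3F\<^sub>n\<^sub>-\<^sub>2 = xF\<^sub>n\<^sub>-\<^sub>3F\<^sub>n\<close>.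
  Shorter ones: \<open>F\<^sub>n = F\<^sub>n\<^sub>-\<^sub>2F\<^sub>n\<^sub>-\<^sub>2F\<^sub>n\<^sub>-\<^sub>5F\<^sub>n\<^sub>-\<^sub>4\<close> ends in \<open>F\<^sub>n\<^sub>-\<^sub>2\<close>, so \<open>F\<^sub>n\<^sub>-\<^sub>2\<close> covers \<open>F\<^sub>n\<close>.
  Conversely a right seed no longer than \<open>F\<^sub>n\<^sub>-\<^sub>2\<close> is also a right seed of \<open>F\<^sub>n\<^sub>-\<^sub>2\<close>, so by
  induction only the lengths strictly between \<open>|F\<^sub>n\<^sub>-\<^sub>3|\<close> and \<open>|F\<^sub>n\<^sub>-\<^sub>1|\<close> other than \<open>|F\<^sub>n\<^sub>-\<^sub>2|\<close>,
  and \<open>|F\<^sub>n\<^sub>-\<^sub>3|\<close> itself, have to be excluded.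
  Such a string ends in \<open>cF\<^sub>k\<close>, with \<open>k = n - 2\<close> or \<open>k = n - 4\<close> and \<open>c\<close> the last letter
  of \<open>F\<^sub>k\<^sub>-\<^sub>1\<close>. As Fibonacci strings are primitive (their letter counts are coprime) and
  \<open>F\<^sub>k\<^sub>-\<^sub>1\<close> and \<open>F\<^sub>k\<close> have different last letters, \<open>cF\<^sub>k\<close> occurs in \<open>F\<^sub>k\<^sub>+\<^sub>2F\<^sub>k\<^sub>+\<^sub>2\<close> only as a suffix of
  one of the two factors, which leaves a gap in the covering.
\<close>

section \<open>Covers and right seeds through the end positions of occurrences\<close>

lemma factor_eq_iff_suffix_take:
  assumes "1 \<le> i" "i + length x \<le> length y + 1" "x \<noteq> []"
  shows "factor y i (i + length x - 1) = x \<longleftrightarrow> suffix x (take (i + length x - 1) y)"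
proof -
  have eq: "take (i + length x - 1) y = take (i - 1) y @ factor y i (i + length x - 1)"
    using assms take_add[of "i - 1" "length x" y] by (simp add: factor_def)
  have len: "length (factor y i (i + length x - 1)) = length x"
    using assms by (simp add: factor_def)
  show ?thesis
  proof
    assume "suffix x (take (i + length x - 1) y)"
    then have "suffix x (factor y i (i + length x - 1))"
      unfolding eq by (rule suffix_length_suffix) (use len in \<open>simp_all add: suffix_def\<close>)
    then show "factor y i (i + length x - 1) = x"
      using len by (auto simp: suffix_def)
  qed (use eq in \<open>metis suffix_def\<close>)
qed

text \<open>Occurrences are indexed by their end \<open>e\<close> and become suffixes of prefixes,
  which fits seeds being suffixes. Here \<open>q\<close> counts from 0, so an occurrence ending at
  \<open>e\<close> covers it iff \<open>q < e <= q + length x\<close>.\<close>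

lemma is_cover_iff:
  "is_cover x y \<longleftrightarrow> x \<noteq> [] \<and> y \<noteq> [] \<and>
     (\<forall>q<length y. \<exists>e. q < e \<and> e \<le> q + length x \<and> e \<le> length y \<and> suffix x (take e y))"
    (is "?L \<longleftrightarrow> ?R")
proof
  assume ?L
  then obtain P where x: "x \<noteq> []" "length x \<le> length y"
    and P: "P \<subseteq> {1..length y - length x + 1}"
    and occ: "\<And>i. i \<in> P \<Longrightarrow> factor y i (i + length x - 1) = x"
    and un: "(\<Union>i\<in>P. {i..i + length x - 1}) = {1..length y}"
    unfolding is_cover_def by blast
  have "\<exists>e. q < e \<and> e \<le> q + length x \<and> e \<le> length y \<and> suffix x (take e y)"
    if q: "q < length y" for q
  proof -
    have "q + 1 \<in> {1..length y}" using q by simp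
    then obtain i where i: "i \<in> P" "q + 1 \<in> {i..i + length x - 1}"
      unfolding un[symmetric] by blast
    then have "1 \<le> i" "i \<le> length y - length x + 1"
      using P by auto
    then have "1 \<le> i" "i + length x \<le> length y + 1"
      using x(2) by simp_all
    then show ?thesis
      using i x occ[of i] factor_eq_iff_suffix_take[of i x y]
      by (intro exI[of _ "i + length x - 1"]) auto
  qed
  then show ?R using x by auto
next
  assume R: ?R
  \<comment> \<open>The set of all occurrences is the largest possible witness.\<close>
  define P where "P = {i. 1 \<le> i \<and> i + length x \<le> length y + 1 \<and> factor y i (i + length x - 1) = x}"
  have cov: "\<exists>i\<in>P. q + 1 \<in> {i..i + length x - 1}" if "q < length y" for q
  proof -
    from R that obtain e where e: "q < e" "e \<le> q + length x" "e \<le> length y" "suffix x (take e y)"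
      by blast
    then have "length x \<le> e" using suffix_length_le[of x "take e y"] by simp
    then show ?thesis
      using e R factor_eq_iff_suffix_take[of "e + 1 - length x" x y]
      by (intro bexI[of _ "e + 1 - length x"]) (auto simp: P_def)
  qed
  have "(\<Union>i\<in>P. {i..i + length x - 1}) = {1..length y}"
  proof (rule set_eqI, rule iffI)
    fix j assume "j \<in> (\<Union>i\<in>P. {i..i + length x - 1})"
    then show "j \<in> {1..length y}" by (auto simp: P_def)
  next
    fix j assume "j \<in> {1..length y}"
    then show "j \<in> (\<Union>i\<in>P. {i..i + length x - 1})" using cov[of "j - 1"] by auto
  qed
  moreover have "length x \<le> length y"
    using R cov[of 0] by (auto simp: P_def)
  moreover have "P \<subseteq> {1..length y - length x + 1}" using \<open>length x \<le> length y\<close> by (auto simp: P_def)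
  ultimately show ?L
    using R unfolding is_cover_def by (intro conjI exI[of _ P]) (auto simp: P_def)
qed

lemma is_cover_refl: "x \<noteq> [] \<Longrightarrow> is_cover x x"
  unfolding is_cover_iff by (auto intro!: exI[of _ "length x"])

text \<open>The occurrence ending at the end of \<open>y @ w\<close> covers all of \<open>w\<close>,
  since \<open>w\<close> is no longer than \<open>x\<close>.\<close>

lemma is_cover_append:
  assumes "is_cover x y" "suffix x (y @ w)" "length w \<le> length x"
  shows "is_cover x (y @ w)"
  unfolding is_cover_iff
proof (intro conjI allI impI)
  fix q assume q: "q < length (y @ w)"
  show "\<exists>e. q < e \<and> e \<le> q + length x \<and> e \<le> length (y @ w) \<and> suffix x (take e (y @ w))"
  proof (cases "q < length y")
    case True
    then obtain e where "q < e" "e \<le> q + length x" "e \<le> length y" "suffix x (take e y)"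
      using assms(1) unfolding is_cover_iff by blast
    then show ?thesis by (intro exI[of _ e]) auto
  next
    case False
    then show ?thesis using q assms(2,3) by (intro exI[of _ "length (y @ w)"]) auto
  qed
qed (use assms(1) in \<open>auto simp: is_cover_iff\<close>)

lemma is_cover_trans:
  assumes "is_cover x y" "is_cover y z"
  shows "is_cover x z"
  unfolding is_cover_iff
proof (intro conjI allI impI)
  fix q assume "q < length z"
  then obtain e where e: "q < e" "e \<le> q + length y" "e \<le> length z" "suffix y (take e z)"
    using assms(2) unfolding is_cover_iff by blast
  then obtain p where p: "take e z = p @ y" by (auto simp: suffix_def)
  then have lp: "e = length p + length y" using e(3) by (metis length_append length_take min.absorb2)
  then have "q - length p < length y" using e by linarith
  then obtain d where d: "q - length p < d" "d \<le> q - length p + length x" "d \<le> length y"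
      "suffix x (take d y)"
    using assms(1) unfolding is_cover_iff by blast
  have "take (length p + d) z = take (length p + d) (take e z)"
    using lp d by (simp add: min_def)
  also have "\<dots> = p @ take d y" using p by simp
  finally have "suffix x (take (length p + d) z)" using d by (simp add: suffix_appendI)
  then show "\<exists>e. q < e \<and> e \<le> q + length x \<and> e \<le> length z \<and> suffix x (take e z)"
    using d e lp by (intro exI[of _ "length p + d"]) linarith
qed (use assms in \<open>auto simp: is_cover_iff\<close>)

text \<open>The last position can only be covered by an occurrence that ends there.\<close>

lemma is_cover_suffix:
  assumes "is_cover x y"
  shows "suffix x y"
proof -
  have "y \<noteq> []" using assms by (simp add: is_cover_iff)
  then have "length y - 1 < length y" by simp
  then obtain e where "length y - 1 < e" "e \<le> length y" "suffix x (take e y)"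
    using assms unfolding is_cover_iff by blast
  moreover from this have "e = length y" by linarith
  ultimately show ?thesis by simp
qed

lemma is_cover_right_seed: "is_cover x y \<Longrightarrow> right_seed x y"
  unfolding right_seed_def
  by (metis is_cover_iff is_cover_suffix append_Nil)

text \<open>If \<open>y = p @ z\<close>, the same covered string extends \<open>z\<close> by
  \<open>v @ p\<close>.\<close>

lemma right_seed_suffix:
  assumes "right_seed s y" "suffix s z" "suffix z y"
  shows "right_seed s z"
  using assms unfolding right_seed_def suffix_def by (metis append.assoc)

text \<open>This eliminates the extension \<open>v\<close>. The occurrence covering \<open>q\<close>
  may start inside \<open>v\<close>, so only those suffixes \<open>u\<close> of \<open>s\<close>
  that fit into the first \<open>e\<close> letters are known to occur in \<open>y\<close>.\<close>

lemma right_seed_occurrence: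
  assumes "right_seed s y" "q < length y"
  obtains e where "q < e" "e \<le> q + length s" "e \<le> length y"
    "\<And>u. suffix u s \<Longrightarrow> length u \<le> e \<Longrightarrow> suffix u (take e y)"
proof -
  from assms obtain v where "is_cover s (v @ y)" unfolding right_seed_def by blast
  moreover have "length v + q < length (v @ y)" using assms by simp
  ultimately obtain e where e: "length v + q < e" "e \<le> length v + q + length s"
      "e \<le> length (v @ y)" "suffix s (take e (v @ y))"
    unfolding is_cover_iff by blast
  define d where "d = e - length v"
  have "take e (v @ y) = v @ take d y" using e by (simp add: d_def)
  moreover have "suffix u (take d y)" if "suffix u s" "length u \<le> d" for u
  proof (rule suffix_length_suffix)
    show "suffix u (v @ take d y)" using that e calculation by (metis suffix_order.trans)
    show "suffix (take d y) (v @ take d y)" by (simp add: suffix_def)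
    show "length u \<le> length (take d y)" using that e by (auto simp: d_def)
  qed
  ultimately show ?thesis using e by (intro that[of d]) (auto simp: d_def)
qed

section \<open>Letter counts and primitivity of Fibonacci strings\<close>

lemma fib_str_not_Nil [simp]: "fib_str n \<noteq> []"
  by (induction n rule: fib_str.induct) auto

lemma length_fib_str_pos [simp]: "0 < length (fib_str n)"
  by simp

lemma last_fib_str: "last (fib_str n) = (if even n then letter_b else letter_a)"
  by (induction n rule: fib_str.induct) auto

lemma count_fib_str_Suc_b:
  "count_list (fib_str (Suc n)) letter_b = count_list (fib_str n) letter_a"
  by (induction n rule: fib_str.induct) auto

text \<open>From one index to the next the counts \<open>(a, b)\<close> become
  \<open>(a + b, a)\<close>, a reversed Euclidean step starting at \<open>(0, 1)\<close>.\<close>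

lemma count_fib_str_coprime:
  "coprime (count_list (fib_str n) letter_a) (count_list (fib_str n) letter_b)"
proof (induction n)
  case (Suc n)
  have "count_list (fib_str (Suc n)) letter_a =
      count_list (fib_str n) letter_a + count_list (fib_str n) letter_b"
    by (cases n) (auto simp: count_fib_str_Suc_b)
  then show ?case
    using Suc by (simp add: count_fib_str_Suc_b coprime_iff_gcd_eq_1 gcd.commute)
qed auto

lemma count_list_concat_replicate:
  "count_list (concat (replicate n xs)) x = n * count_list xs x"
  by (induction n) auto

text \<open>The occurrence lies inside the square; \<open>z\<close> is only padding. It forces
  \<open>x @ y = y @ x\<close>, so \<open>x\<close> and \<open>y\<close> are powers of one
  \<open>w\<close>; the sum of the exponents is at least 2 and divides both letter counts.\<close>

lemma fib_str_primitive:
  assumes "prefix (fib_str n) (drop t (fib_str n @ fib_str n @ z))" "0 < t" "t < length (fib_str n)"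
  shows False
proof -
  define x where "x = take t (fib_str n)"
  define y where "y = drop t (fib_str n)"
  have F: "fib_str n = x @ y" by (simp add: x_def y_def)
  have ne: "x \<noteq> []" "y \<noteq> []" using assms(2,3) by (auto simp: x_def y_def)
  have "t = length x" using assms(3) by (simp add: x_def)
  then have "prefix (x @ y) (y @ x @ y @ z)"
    using assms(1) unfolding F by simp
  then have "prefix (x @ y) ((y @ x) @ y @ z)" by simp
  moreover have "prefix (y @ x) ((y @ x) @ y @ z)" by (rule prefixI) simp
  moreover have "length (x @ y) = length (y @ x)" by simp
  ultimately have "x @ y = y @ x"
    by (metis prefix_length_prefix prefix_order.antisym order_refl)
  then obtain i j w where w: "concat (replicate i w) = x" "concat (replicate j w) = y"
    using comm_append_are_replicate[of x y] by blast
  have cnt: "count_list (fib_str n) l = (i + j) * count_list w l" for l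
    unfolding F w[symmetric] by (simp add: count_list_concat_replicate algebra_simps)
  then have "i + j dvd 1"
    using count_fib_str_coprime[of n] by (metis coprime_common_divisor dvd_triv_left)
  moreover have "i \<noteq> 0" "j \<noteq> 0" using w ne by auto
  ultimately show False by simp
qed

section \<open>Occurrences of a marked Fibonacci string in a square\<close>

lemma suffix_Cons_takeD:
  assumes "suffix (c # u) (take e y)" "e \<le> length y"
  shows "prefix u (drop (e - length u) y) \<and> y ! (e - length u - 1) = c \<and> length u < e"
proof -
  from assms obtain p where p: "take e y = p @ c # u" by (auto simp: suffix_def)
  have "e = length (take e y)" using assms(2) by simp
  then have e: "e = length p + 1 + length u" unfolding p by simp
  have "y = p @ c # u @ drop e y"
    using append_take_drop_id[of e y] unfolding p by simp
  then obtain z where y: "y = p @ c # u @ z" by blast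
  show ?thesis unfolding y e by simp
qed

lemma fib_str_last_Cons_not_inside_square:
  assumes "length (fib_str (k + 3)) < e" "e < 2 * length (fib_str (k + 3))"
  shows "\<not> suffix (last (fib_str k) # fib_str (k + 1)) (take e (fib_str (k + 3) @ fib_str (k + 3)))"
proof
  assume suf: "suffix (last (fib_str k) # fib_str (k + 1)) (take e (fib_str (k + 3) @ fib_str (k + 3)))"
  show False
  \<comment> \<open>The strings \<open>C\<close> and \<open>D\<close> below need
    \<open>2 <= k\<close>; the two smaller cases are computed.\<close>
  proof (cases "k < 2")
    case True
    then consider "k = 0" | "k = 1" by linarith
    then show False
    proof cases
      case 1
      then have "e \<in> {4, 5}" using assms by (auto simp: numeral_3_eq_3)
      then show False using suf 1
        by (auto simp: numeral_eq_Suc suffix_def Cons_eq_append_conv)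
    next
      case 2
      then have "e \<in> {6, 7, 8, 9}" using assms by (auto simp: numeral_eq_Suc)
      then show False using suf 2
        by (auto simp: numeral_eq_Suc suffix_def Cons_eq_append_conv)
    qed
  next
    case False
    define A where "A = fib_str (k + 1)"
    define B where "B = fib_str k"
    define C where "C = fib_str (k - 1)"
    define D where "D = fib_str (k - 2)"
    define Y where "Y = A @ B @ A @ A @ B @ A"
    obtain j where j: "k = j + 2" using False by (metis le_add_diff_inverse2 not_less)
    have A: "A = B @ C" and B: "B = C @ D" by (simp_all add: A_def B_def C_def D_def j)
    have F3: "fib_str (k + 3) = A @ B @ A"
      by (simp add: A_def B_def numeral_3_eq_3)
    have A0: "A \<noteq> []" "B \<noteq> []" by (simp_all add: A_def B_def)
    have last_ne: "last A \<noteq> last B" by (simp add: A_def B_def last_fib_str)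
    have eY: "e \<le> length Y" and lF: "length (fib_str (k + 3)) = 2 * length A + length B"
      using assms by (simp_all add: F3 Y_def)
    have "suffix (last B # A) (take e Y)"
      using suf by (simp add: F3 Y_def A_def B_def)
    \<comment> \<open>The end position is turned into an offset, the form used by primitivity,
      together with the letter before it.\<close>
    from suffix_Cons_takeD[OF this eY]
    have pre: "prefix A (drop (e - length A) Y)" and c: "Y ! (e - length A - 1) = last B" by auto
    define t where "t = e - (2 * length A + length B)"
    have t: "0 < t" "t < 2 * length A + length B" and et: "e = 2 * length A + length B + t"
      using assms unfolding lF t_def by simp_all
    have preA: "prefix A (drop t (A @ A @ B @ A))"
      using pre by (simp add: Y_def et)
    show False
    proof (cases "t < length A")
      case True
      then show False using fib_str_primitive[of "k + 1" t "B @ A"] preA t by (simp add: A_def)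
    next
      case False
      define r where "r = t - length A"
      have r: "t = length A + r" using False by (simp add: r_def)
      have preR: "prefix A (drop r (A @ B @ A))" using preA by (simp add: r)
      have nth_last: "(w @ z) ! (length w - 1) = last w" if "w \<noteq> []" for w z :: str
        using that by (simp add: nth_append last_conv_nth)
      \<comment> \<open>At these two offsets \<open>A\<close> does occur; only the preceding letter,
        the last of \<open>A\<close> and not of \<open>B\<close>, is wrong.\<close>
      have "Y ! (e - length A - 1) = last A" if "r = 0 \<or> r = length A"
        using that
      proof
        assume "r = 0"
        then have "e - length A - 1 = length (A @ B @ A) - 1" by (simp add: et r)
        then show ?thesis using nth_last[of "A @ B @ A" "A @ B @ A"] A0 by (simp add: Y_def)
      next
        assume "r = length A"
        then have "e - length A - 1 = length (A @ B @ A @ A) - 1" by (simp add: et r)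
        then show ?thesis using nth_last[of "A @ B @ A @ A" "B @ A"] A0 by (simp add: Y_def)
      qed
      then have r_ne: "r \<noteq> 0" "r \<noteq> length A" using c last_ne by metis+
      show False
      proof (cases "r < length A")
        case True
        \<comment> \<open>Hence \<open>A @ B @ A\<close> starts with the square of
          \<open>A\<close>.\<close>
        have "B @ A = A @ D @ C" by (simp add: A B)
        then show False
          using fib_str_primitive[of "k + 1" r "D @ C"] preR r_ne True by (simp add: A_def)
      next
        case False
        define i where "i = r - length A"
        have "r = length A + i" using False by (simp add: i_def)
        then have "prefix A (drop i (B @ A))" "0 < i" "i < length B"
          using preR r_ne t r by auto
        \<comment> \<open>Here \<open>A\<close> starts with \<open>B\<close>, and
          \<open>B @ A = B @ B @ C\<close> starts with the square of \<open>B\<close>.\<close>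
        then show False
          using fib_str_primitive[of k i C] by (auto simp: A B_def[symmetric] dest: append_prefixD)
      qed
    qed
  qed
qed

section \<open>Excluding all other lengths\<close>

lemma suffix_fib_str_long:
  assumes "suffix s (fib_str (k + 3))" "length (fib_str (k + 1)) < length s"
  shows "suffix (last (fib_str k) # fib_str (k + 1)) s"
proof -
  have "fib_str (k + 3) =
      (fib_str (k + 1) @ butlast (fib_str k)) @ last (fib_str k) # fib_str (k + 1)"
    using append_butlast_last_id[of "fib_str k"] by (simp add: numeral_3_eq_3)
  then have "suffix (last (fib_str k) # fib_str (k + 1)) (fib_str (k + 3))"
    by (rule suffixI)
  then show ?thesis using assms by (auto intro: suffix_length_suffix)
qed

lemma right_seed_fib_str_length_not_between:
  assumes "right_seed s (fib_str (k + 3))" "length (fib_str (k + 1)) < length s"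
  shows "length (fib_str (k + 2)) \<le> length s"
proof (rule ccontr)
  let ?F = "fib_str (k + 3)" and ?u = "last (fib_str k) # fib_str (k + 1)"
  assume "\<not> length (fib_str (k + 2)) \<le> length s"
  moreover have len: "length ?F = length (fib_str (k + 2)) + length (fib_str (k + 1))"
    by (simp add: numeral_3_eq_3)
  ultimately have q: "length ?F - length s - 1 < length ?F"
      "length (fib_str (k + 1)) + length s < length ?F"
    by auto
  \<comment> \<open>The position just before the suffix \<open>s\<close> of \<open>?F\<close> is
    chosen: its occurrence ends strictly before the end of \<open>?F\<close>, yet by the second part
    of \<open>q\<close> late enough for \<open>?u\<close> to fit.\<close>
  from right_seed_occurrence[OF assms(1) q(1)] obtain e where
    e: "length ?F - length s - 1 < e" "e \<le> length ?F - length s - 1 + length s" "e \<le> length ?F"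
    and occ: "\<And>u. suffix u s \<Longrightarrow> length u \<le> e \<Longrightarrow> suffix u (take e ?F)" by blast
  have "suffix ?u s"
    using assms suffix_fib_str_long unfolding right_seed_def by blast
  moreover have "length ?u \<le> e" using e q by simp
  ultimately have "suffix ?u (take e ?F)" by (rule occ)
  \<comment> \<open>A copy of \<open>?F\<close> in front moves the end into the second factor of the
    square.\<close>
  then have "suffix ?u (take (length ?F + e) (?F @ ?F))" by (simp add: suffix_appendI)
  moreover have "length ?F < length ?F + e" "length ?F + e < 2 * length ?F" using e q by linarith+
  ultimately show False using fib_str_last_Cons_not_inside_square by blast
qed

text \<open>The square prefix serves to exclude seeds; the tail, shorter than
  \<open>fib_str (k + 3)\<close>, serves to show that this string is a cover.\<close>

lemma fib_str_near_cube:
  "fib_str (k + 5) = fib_str (k + 3) @ fib_str (k + 3) @ fib_str k @ fib_str (k + 1)"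
  by (simp add: numeral_eq_Suc)

text \<open>For \<open>n = k + 5\<close> this is the lower of the two excluded ranges of lengths;
  \<open>right_seed_fib_str_length_not_between\<close> handles the upper one.\<close>

lemma right_seed_fib_str_short:
  assumes "right_seed s (fib_str (k + 5))" "suffix s (fib_str (k + 3))"
    "length (fib_str (k + 2)) \<le> length s"
  shows "s = fib_str (k + 3)"
proof (rule ccontr)
  let ?F = "fib_str (k + 3)" and ?u = "last (fib_str k) # fib_str (k + 1)"
  assume ne: "s \<noteq> ?F"
  have ls: "length s < length ?F"
    using assms(2) ne by (metis suffix_def append_Nil length_append length_greater_0_conv
        less_add_same_cancel2)
  have "length ?F < length (fib_str (k + 5))" by (simp add: fib_str_near_cube)
  \<comment> \<open>The chosen position is the first letter of the second factor \<open>?F\<close>;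
    as \<open>s\<close> is shorter than \<open>?F\<close>, its occurrence ends strictly inside that
    factor.\<close>
  from right_seed_occurrence[OF assms(1) this] obtain e where
    e: "length ?F < e" "e \<le> length ?F + length s"
    and occ: "\<And>u. suffix u s \<Longrightarrow> length u \<le> e \<Longrightarrow> suffix u (take e (fib_str (k + 5)))" by blast
  have "length (fib_str (k + 1)) < length s"
    using assms(3) length_fib_str_pos[of k] by (simp del: length_fib_str_pos length_greater_0_conv)
  then have "suffix ?u s" using assms(2) suffix_fib_str_long by blast
  moreover have "length ?u \<le> e" using e suffix_length_le[OF calculation] ls by linarith
  ultimately have "suffix ?u (take e (fib_str (k + 5)))" by (rule occ)
  moreover have "take e (fib_str (k + 5)) = take e (?F @ ?F)"
    using e ls by (simp add: fib_str_near_cube)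
  ultimately show False
    using fib_str_last_Cons_not_inside_square[of k e] e ls by simp
qed

text \<open>In \<open>aba\<close> the \<open>b\<close> stays uncovered by \<open>a\<close>. In
  \<open>abaab\<close> the first letter of \<open>aa\<close> stays uncovered by \<open>b\<close> and
  \<open>ab\<close>, as the prefixes of lengths 3 and 4 end in \<open>a\<close>.\<close>

lemma right_seed_fib_str_3_4:
  assumes "right_seed s (fib_str n)" "n = 3 \<or> n = 4"
  shows "length (fib_str (n - 1)) \<le> length s"
proof (rule ccontr)
  assume "\<not> length (fib_str (n - 1)) \<le> length s"
  then have l: "length s < length (fib_str (n - 1))" by simp
  have s: "s \<noteq> []" "suffix s (fib_str n)" using assms(1) by (auto simp: right_seed_def)
  from assms(2) show False
  proof
    assume n: "n = 3"
    then have "s = [letter_a]"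
      using l s by (auto simp: numeral_eq_Suc suffix_Cons)
    moreover from right_seed_occurrence[OF assms(1), of 1] obtain e where "1 < e" "e \<le> 1 + length s"
      and "\<And>u. suffix u s \<Longrightarrow> length u \<le> e \<Longrightarrow> suffix u (take e (fib_str n))"
      using n by (auto simp: numeral_eq_Suc)
    moreover from calculation have "e = 2" by simp
    ultimately have "suffix s (take 2 (fib_str n))" by simp
    then show False using \<open>s = _\<close> n by (simp add: numeral_eq_Suc suffix_Cons)
  next
    assume n: "n = 4"
    then have s2: "s = [letter_b] \<or> s = [letter_a, letter_b]"
      using l s by (auto simp: numeral_eq_Suc suffix_Cons)
    from right_seed_occurrence[OF assms(1), of 2] obtain e where e: "2 < e" "e \<le> 2 + length s"
      and occ: "\<And>u. suffix u s \<Longrightarrow> length u \<le> e \<Longrightarrow> suffix u (take e (fib_str n))"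
      using n by (auto simp: numeral_eq_Suc)
    then have "suffix s (take e (fib_str n))" "e = 3 \<or> e = 4 \<and> length s = 2" using s2 by auto
    then show False using s2 n by (auto simp: numeral_eq_Suc suffix_Cons)
  qed
qed

lemma right_seed_fib_strD:
  assumes "right_seed s (fib_str n)" "3 \<le> n"
  shows "length (fib_str (n - 1)) \<le> length s \<or>
    (\<exists>i. 3 \<le> i \<and> i \<le> n \<and> even (i + n) \<and> s = fib_str i)"
  using assms
proof (induction n rule: less_induct)
  case (less n)
  show ?case
  proof (cases "n < 5")
    case True
    then have "n = 3 \<or> n = 4" using less.prems by linarith
    then show ?thesis using less.prems right_seed_fib_str_3_4 by blast
  next
    case False
    then obtain k where n: "n = k + 5" by (metis le_add_diff_inverse2 not_less)
    show ?thesis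
    proof (cases "length (fib_str (k + 3)) < length s")
      case True
      then show ?thesis
        using right_seed_fib_str_length_not_between[of s "k + 2"] less.prems n
        by (simp add: numeral_eq_Suc)
    next
      case False
      have suf: "suffix (fib_str (k + 3)) (fib_str n)" by (simp add: n numeral_eq_Suc suffix_def)
      then have s: "suffix s (fib_str (k + 3))"
        using False less.prems(1) by (auto simp: right_seed_def intro: suffix_length_suffix)
      then have "right_seed s (fib_str (k + 3))"
        using less.prems(1) suf right_seed_suffix by blast
      with less.IH[of "k + 3"] consider "length (fib_str (k + 2)) \<le> length s"
        | i where "3 \<le> i" "i \<le> k + 3" "even (i + (k + 3))" "s = fib_str i"
        by (auto simp: n)
      then show ?thesis
      proof cases
        \<comment> \<open>Of the long seeds of \<open>fib_str (k + 3)\<close>, only that string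
          itself remains a seed of \<open>fib_str (k + 5)\<close>.\<close>
        case 1
        then have "s = fib_str (k + 3)" using less.prems(1) s right_seed_fib_str_short n by blast
        then show ?thesis by (intro disjI2 exI[of _ "k + 3"]) (simp add: n)
      next
        case 2
        then show ?thesis by (intro disjI2 exI[of _ i]) (simp add: n)
      qed
    qed
  qed
qed

section \<open>Constructing right seeds and characterizing them\<close>

lemma fib_str_is_cover_add_2:
  assumes "3 \<le> k"
  shows "is_cover (fib_str k) (fib_str (k + 2))"
proof -
  \<comment> \<open>Below 3 the claim fails: \<open>a\<close> does not cover \<open>aba\<close>, nor
    \<open>ab\<close> the string \<open>abaab\<close>.\<close>
  obtain j where k: "k = j + 3" using assms by (metis le_add_diff_inverse2)
  have "is_cover (fib_str k) (fib_str k @ fib_str k)"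
    by (rule is_cover_append) (simp_all add: is_cover_refl suffix_def)
  moreover have F: "fib_str (k + 2) = (fib_str k @ fib_str k) @ fib_str j @ fib_str (j + 1)"
    using fib_str_near_cube[of j] by (simp add: k eval_nat_numeral)
  moreover have "suffix (fib_str k) (fib_str (k + 2))" by (simp add: suffix_def)
  moreover have "length (fib_str j @ fib_str (j + 1)) \<le> length (fib_str k)"
    by (simp add: k numeral_3_eq_3)
  ultimately show ?thesis using is_cover_append by metis
qed

lemma fib_str_is_cover_even:
  assumes "3 \<le> k"
  shows "is_cover (fib_str k) (fib_str (k + 2 * d))"
proof (induction d)
  case 0
  show ?case by (simp add: is_cover_refl)
next
  case (Suc d)
  have "is_cover (fib_str (k + 2 * d)) (fib_str (k + 2 * d + 2))"
    using assms by (intro fib_str_is_cover_add_2) simp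
  then show ?case using Suc is_cover_trans by simp
qed

lemma right_seed_fib_str_long:
  assumes "suffix x (fib_str (m + 1))"
  shows "right_seed (x @ fib_str m @ fib_str (m + 1)) (fib_str (m + 3))"
proof -
  let ?w = "fib_str m @ fib_str (m + 1)"
  have F: "fib_str (m + 3) = fib_str (m + 1) @ ?w" by (simp add: numeral_3_eq_3)
  then have suf: "suffix (x @ ?w) (fib_str (m + 3))" using assms by (auto simp: suffix_def)
  \<comment> \<open>The witness for \<open>v\<close> is \<open>x @ fib_str m\<close>.\<close>
  have eq: "(x @ ?w) @ ?w = (x @ fib_str m) @ fib_str (m + 3)" by (simp add: F)
  have "suffix (x @ ?w) ((x @ ?w) @ ?w)" using suf unfolding eq by (rule suffix_appendI)
  then have "is_cover (x @ ?w) ((x @ ?w) @ ?w)"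
    by (intro is_cover_append is_cover_refl) auto
  moreover have "x @ ?w \<noteq> []" by simp
  ultimately show ?thesis using suf unfolding right_seed_def eq by blast
qed

text \<open>Writing the index as \<open>m + 3\<close> avoids truncated subtraction, and the parity
  condition treats odd and even indices together.\<close>

lemma right_seed_fib_str_iff:
  "right_seed s (fib_str (m + 3)) \<longleftrightarrow>
     (\<exists>i. 3 \<le> i \<and> i \<le> m + 3 \<and> even (i + (m + 3)) \<and> s = fib_str i) \<or>
     (\<exists>x. suffix x (fib_str (m + 1)) \<and> s = x @ fib_str m @ fib_str (m + 1))"
    (is "?L \<longleftrightarrow> ?I \<or> ?X")
proof
  assume L: ?L
  show "?I \<or> ?X"
  proof (cases "length (fib_str (m + 2)) \<le> length s")
    case False
    then show ?thesis using right_seed_fib_strD[OF L] by auto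
  next
    case True
    let ?w = "fib_str m @ fib_str (m + 1)"
    have F: "fib_str (m + 3) = fib_str (m + 1) @ ?w" by (simp add: numeral_3_eq_3)
    have s: "suffix s (fib_str (m + 3))" using L by (simp add: right_seed_def)
    moreover have "suffix ?w (fib_str (m + 3))" by (simp add: F suffix_def)
    \<comment> \<open>\<open>?w\<close> has the two factors of \<open>fib_str (m + 2)\<close> in the
      other order, hence the same length.\<close>
    moreover have "length ?w \<le> length s" using True by simp
    ultimately have "suffix ?w s" by (auto intro: suffix_length_suffix)
    then obtain x where x: "s = x @ ?w" by (auto simp: suffix_def)
    then have "suffix x (fib_str (m + 1))" using s by (simp add: F suffix_def)
    then show ?thesis using x by blast
  qed
next
  assume "?I \<or> ?X"
  then show ?L
  proof
    assume ?I
    then obtain i where i: "3 \<le> i" "i \<le> m + 3" "even (i + (m + 3))" "s = fib_str i" by blast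
    then have "even (m + 3 - i)" by simp
    then obtain d where "m + 3 - i = 2 * d" by (elim evenE)
    then have "m + 3 = i + 2 * d" using i by linarith
    then show ?L using i fib_str_is_cover_even[of i d] is_cover_right_seed by metis
  next
    assume ?X
    then show ?L using right_seed_fib_str_long by blast
  qed
qed

section \<open>Small indices and the split by parity\<close>

lemma right_seed_fib_str_2: "right_seed s (fib_str 2) \<Longrightarrow> s = fib_str 2"
proof (rule ccontr)
  assume R: "right_seed s (fib_str 2)" and "s \<noteq> fib_str 2"
  then have s: "s = [letter_b]"
    by (auto simp: right_seed_def numeral_2_eq_2 suffix_Cons)
  from right_seed_occurrence[OF R, of 0] obtain e where "0 < e" "e \<le> length s"
    and "\<And>u. suffix u s \<Longrightarrow> length u \<le> e \<Longrightarrow> suffix u (take e (fib_str 2))"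
    by auto
  then have "suffix s (take 1 (fib_str 2))" using s by (simp add: le_Suc_eq)
  then show False using s by (simp add: numeral_2_eq_2 suffix_Cons)
qed

theorem theorem3:
  fixes n :: nat
  shows
    "(n \<in> {0, 1, 2} \<longrightarrow>
        {s. right_seed s (fib_str n)} = {fib_str n}) \<and>
     (\<forall>k\<ge>1. n = 2 * k + 1 \<longrightarrow>
        {s. right_seed s (fib_str n)} =
          {fib_str (2 * j + 1) | j. 1 \<le> j \<and> j \<le> k} \<union>
          {x @ fib_str (n - 3) @ fib_str (n - 2) | x. suffix x (fib_str (n - 2))}) \<and>
     (\<forall>k\<ge>2. n = 2 * k \<longrightarrow>
        {s. right_seed s (fib_str n)} =
          {fib_str (2 * j) | j. 2 \<le> j \<and> j \<le> k} \<union>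
          {x @ fib_str (n - 3) @ fib_str (n - 2) | x. suffix x (fib_str (n - 2))})"
proof (intro conjI impI allI)
  assume n: "n \<in> {0, 1, 2}"
  have "s = fib_str n" if "right_seed s (fib_str n)" for s
    \<comment> \<open>For \<open>n = 0\<close> and \<open>n = 1\<close> the string is a single
      letter.\<close>
    using n that right_seed_fib_str_2 by (auto simp: right_seed_def suffix_Cons)
  moreover have "right_seed (fib_str n) (fib_str n)"
    by (simp add: is_cover_refl is_cover_right_seed)
  ultimately show "{s. right_seed s (fib_str n)} = {fib_str n}" by blast
next
  fix k :: nat assume k: "1 \<le> k" and n: "n = 2 * k + 1"
  define m where "m = n - 3"
  have m: "n = m + 3" "n - 2 = m + 1" "n - 3 = m" using k n by (auto simp: m_def)
  \<comment> \<open>As \<open>n\<close> is odd, \<open>i\<close> is odd, and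
    \<open>i = 2 * j + 1 >= 3\<close> means \<open>j >= 1\<close>.\<close>
  have "(\<exists>i. 3 \<le> i \<and> i \<le> n \<and> even (i + n) \<and> s = fib_str i) \<longleftrightarrow>
      (\<exists>j. s = fib_str (2 * j + 1) \<and> 1 \<le> j \<and> j \<le> k)" for s
  proof
    assume "\<exists>i. 3 \<le> i \<and> i \<le> n \<and> even (i + n) \<and> s = fib_str i"
    then obtain i where i: "3 \<le> i" "i \<le> n" "odd i" "s = fib_str i" using n by auto
    then obtain j where "i = 2 * j + 1" by (elim oddE)
    then show "\<exists>j. s = fib_str (2 * j + 1) \<and> 1 \<le> j \<and> j \<le> k" using i n by (intro exI[of _ j]) simp
  next
    assume "\<exists>j. s = fib_str (2 * j + 1) \<and> 1 \<le> j \<and> j \<le> k"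
    then obtain j where "s = fib_str (2 * j + 1)" "1 \<le> j" "j \<le> k" by blast
    then show "\<exists>i. 3 \<le> i \<and> i \<le> n \<and> even (i + n) \<and> s = fib_str i"
      using n by (intro exI[of _ "2 * j + 1"]) simp
  qed
  then show "{s. right_seed s (fib_str n)} =
      {fib_str (2 * j + 1) | j. 1 \<le> j \<and> j \<le> k} \<union>
      {x @ fib_str (n - 3) @ fib_str (n - 2) | x. suffix x (fib_str (n - 2))}"
    using right_seed_fib_str_iff[of _ m] unfolding m(2,3) m(1)[symmetric] by blast
next
  fix k :: nat assume k: "2 \<le> k" and n: "n = 2 * k"
  define m where "m = n - 3"
  have m: "n = m + 3" "n - 2 = m + 1" "n - 3 = m" using k n by (auto simp: m_def)
  \<comment> \<open>For even \<open>i = 2 * j\<close> the bound \<open>3 <= i\<close> means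
    \<open>j >= 2\<close>.\<close>
  have "(\<exists>i. 3 \<le> i \<and> i \<le> n \<and> even (i + n) \<and> s = fib_str i) \<longleftrightarrow>
      (\<exists>j. s = fib_str (2 * j) \<and> 2 \<le> j \<and> j \<le> k)" for s
  proof
    assume "\<exists>i. 3 \<le> i \<and> i \<le> n \<and> even (i + n) \<and> s = fib_str i"
    then obtain i where i: "3 \<le> i" "i \<le> n" "even i" "s = fib_str i" using n by auto
    then obtain j where "i = 2 * j" by (elim evenE)
    then show "\<exists>j. s = fib_str (2 * j) \<and> 2 \<le> j \<and> j \<le> k" using i n by (intro exI[of _ j]) simp
  next
    assume "\<exists>j. s = fib_str (2 * j) \<and> 2 \<le> j \<and> j \<le> k"
    then obtain j where "s = fib_str (2 * j)" "2 \<le> j" "j \<le> k" by blast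
    then show "\<exists>i. 3 \<le> i \<and> i \<le> n \<and> even (i + n) \<and> s = fib_str i"
      using n by (intro exI[of _ "2 * j"]) simp
  qed
  then show "{s. right_seed s (fib_str n)} =
      {fib_str (2 * j) | j. 2 \<le> j \<and> j \<le> k} \<union>
      {x @ fib_str (n - 3) @ fib_str (n - 2) | x. suffix x (fib_str (n - 2))}"
    using right_seed_fib_str_iff[of _ m] unfolding m(2,3) m(1)[symmetric] by blast
qed

end
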